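(* For any integers $d\geq 3$ and $D\geq 3$, the Kautz digraph $K(d,D)$ satisfies: 1. $Z(K(d,D))=(d-1)d^{D-2}(d+1)$; 2. $M(K(d,D))=(d-1)d^{D-2}(d+1)$; 3. $\mathrm{mr}(K(d,D))=d^{D-2}(d+1)$; 4. $\gamma_P(K(d,D))=(d-1)d^{D-3}(d+1)$.
   Context: Kautz digraph: $K(d,1)=K^*_{d+1}$ is the complete symmetric digraph of order $d+1$ without loops (all ordered pairs of distinct vertices are arcs), and $K(d,D)=L(K(d,D-1))$ for $D\geq 2$; so $K(d,D)=L^{D-1}(K^*_{d+1})$ has order $d^{D-1}(d+1)$. Here the line digraph $L(G)$ has vertex set $\{uv:(u,v)\in A(G)\}$, with an arc from $uv$ to $xy$ exactly when $v=x$, and $L^0(G)=G$, $L^r(G)=L(L^{r-1}(G))$. A digraph $H$ has vertex set $V(H)$ and arc set $A(H)\subseteq V(H)\times V(H)$; loops are allowed. $N^+_H(v)=\{u:(v,u)\in A(H)\}$, $N^+_H[v]=N^+_H(v)\cup\{v\}$, $N^+_H[S]=\bigcup_{v\in S}N^+_H[v]$. Zero forcing in a digraph $H$: for non-empty $S\subseteq V(H)$ put $B^0(S)=S$ and, for $i\ge 0$: if $H$ has no loops, $B^{i+1}(S)=B^i(S)\cup\{v\in V(H)\setminus B^i(S):\exists u\in B^i(S),\ N^+_H(u)\setminus B^i(S)=\{v\}\}$; if $H$ has at least one loop, $B^{i+1}(S)=B^i(S)\cup\{v\in V(H)\setminus B^i(S):\exists u\in V(H),\ N^+_H(u)\setminus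 B^i(S)=\{v\}\}$. $S$ is a zero forcing set if $B^m(S)=V(H)$ for some $m\ge 0$. $Z(H)$ is the minimum cardinality of a zero forcing set of $H$. Power domination in $H$: for non-empty $S\subseteq V(H)$ put $P^0(S)=S$, $P^1(S)=N^+_H[S]$, and for $i\geq 1$ obtain $P^{i+1}(S)$ from $P^i(S)$ by the same rule by which $B^{i+1}(S)$ is obtained from $B^i(S)$ (the loopless rule if $H$ has no loops, the other rule if $H$ has at least one loop). $S$ is a power dominating set if $P^t(S)=V(H)$ for some $t\ge 0$. $\gamma_P(H)$ is the minimum cardinality of a power dominating set of $H$. Maximum nullity and minimum rank: for a digraph $H$ of order $p$, let $\mathcal S(H)$ be the set of real $p\times p$ matrices $X$ such that: if $H$ has no loops, for all $i\neq j$, $X_{i,j}\neq 0\Leftrightarrow (i,j)\in A(H)$ (diagonal arbitrary); if $H$ has at least one loop, for all $i,j$, $X_{i,j}\neq 0\Leftrightarrow (i,j)\in A(H)$. $M(H)=\max\{\dim\ker X:X\in\mathcal S(H)\}$ and $\mathrm{mr}(H)=\min\{\operatorname{rank}X:X\in\mathcal S(H)\}$. *)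

theory Defs
  imports
    "Graph_Theory.Pair_Digraph"
    "Jordan_Normal_Form.Matrix_Kernel"
    "Jordan_Normal_Form.DL_Rank"
begin

text \<open>
  The vertices of the line digraph of \<open>G\<close> are the arcs of \<open>G\<close>. So that the construction can be
  iterated a variable number of times within a single type, the arc from \<open>u\<close> to \<open>v\<close>, seen as a
  vertex, is the formal pair \<open>Arc u v\<close>.
\<close>

datatype 'a line_vertex = Vertex 'a | Arc "'a line_vertex" "'a line_vertex"

definition line_digraph ::
  "'a line_vertex pair_pre_digraph \<Rightarrow> 'a line_vertex pair_pre_digraph" where
  "line_digraph G =
     \<lparr> pverts = {Arc u v | u v. (u, v) \<in> parcs G},
       parcs = {(Arc u v, Arc x y) | u v x y. (u, v) \<in> parcs G \<and> (x, y) \<in> parcs G \<and> v = x} \<rparr>"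

definition complete_loopless :: "nat \<Rightarrow> nat line_vertex pair_pre_digraph" where
  "complete_loopless n =
     \<lparr> pverts = Vertex ` {..<n},
       parcs = {(u, v). u \<in> Vertex ` {..<n} \<and> v \<in> Vertex ` {..<n} \<and> u \<noteq> v} \<rparr>"

text \<open>Meaningful for \<open>D \<ge> 1\<close> only.\<close>

definition kautz :: "nat \<Rightarrow> nat \<Rightarrow> nat line_vertex pair_pre_digraph" where
  "kautz d D = (line_digraph ^^ (D - 1)) (complete_loopless (d + 1))"

definition has_loop :: "'a pair_pre_digraph \<Rightarrow> bool" where
  "has_loop H \<longleftrightarrow> (\<exists>v \<in> pverts H. (v, v) \<in> parcs H)"

definition out_nbrs :: "'a pair_pre_digraph \<Rightarrow> 'a \<Rightarrow> 'a set" where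
  "out_nbrs H v = {u. (v, u) \<in> parcs H}"

definition closed_out_nbrs :: "'a pair_pre_digraph \<Rightarrow> 'a set \<Rightarrow> 'a set" where
  "closed_out_nbrs H S = (\<Union>v\<in>S. out_nbrs H v \<union> {v})"

definition force_step :: "'a pair_pre_digraph \<Rightarrow> 'a set \<Rightarrow> 'a set" where
  "force_step H B = B \<union>
     {v \<in> pverts H - B. \<exists>u \<in> (if has_loop H then pverts H else B). out_nbrs H u - B = {v}}"

definition zero_forcing_set :: "'a pair_pre_digraph \<Rightarrow> 'a set \<Rightarrow> bool" where
  "zero_forcing_set H S \<longleftrightarrow>
     S \<noteq> {} \<and> S \<subseteq> pverts H \<and> (\<exists>m. (force_step H ^^ m) S = pverts H)"

definition zero_forcing_number :: "'a pair_pre_digraph \<Rightarrow> nat" where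
  "zero_forcing_number H = Min (card ` {S. zero_forcing_set H S})"

fun power_step :: "'a pair_pre_digraph \<Rightarrow> nat \<Rightarrow> 'a set \<Rightarrow> 'a set" where
  "power_step H 0 S = S"
| "power_step H (Suc 0) S = closed_out_nbrs H S"
| "power_step H (Suc (Suc i)) S = force_step H (power_step H (Suc i) S)"

definition power_dominating_set :: "'a pair_pre_digraph \<Rightarrow> 'a set \<Rightarrow> bool" where
  "power_dominating_set H S \<longleftrightarrow>
     S \<noteq> {} \<and> S \<subseteq> pverts H \<and> (\<exists>t. power_step H t S = pverts H)"

definition power_domination_number :: "'a pair_pre_digraph \<Rightarrow> nat" where
  "power_domination_number H = Min (card ` {S. power_dominating_set H S})"

text \<open>
  Rows and columns of a \<open>real mat\<close> are indexed by \<open>0, \<dots>, p - 1\<close>, so a matrix is read through a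
  numbering \<open>f\<close> of the vertices, the same for rows and columns. All numberings are admitted;
  changing the numbering conjugates a matrix by a permutation matrix and hence affects neither
  its rank nor its nullity. For loopless \<open>H\<close> the diagonal entries are unconstrained.
\<close>

definition digraph_matrices :: "'a pair_pre_digraph \<Rightarrow> real mat set" where
  "digraph_matrices H = (let p = card (pverts H) in
     {X \<in> carrier_mat p p. \<exists>f. bij_betw f {..<p} (pverts H) \<and>
        (\<forall>i<p. \<forall>j<p. has_loop H \<or> i \<noteq> j \<longrightarrow>
           (X $$ (i, j) \<noteq> 0 \<longleftrightarrow> (f i, f j) \<in> parcs H))})"

definition max_nullity :: "'a pair_pre_digraph \<Rightarrow> nat" where
  "max_nullity H = Max (kernel_dim ` digraph_matrices H)"

definition min_rank :: "'a pair_pre_digraph \<Rightarrow> nat" where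
  "min_rank H = Min (vec_space.rank (card (pverts H)) ` digraph_matrices H)"

end

theory Submission
  imports Defs
begin

text \<open>
  A Kautz digraph with \<open>D \<ge> 3\<close> is an iterated line digraph \<open>L (L F)\<close> of a \<open>d\<close>-regular digraph \<open>F\<close>.
  In the line digraph \<open>L G\<close> of a \<open>d\<close>-regular \<open>G\<close> with \<open>m\<close> vertices, all in-arcs of a vertex \<open>v\<close> of
  \<open>G\<close> have the same out-neighbours, namely all out-arcs of \<open>v\<close>. So the vertices of \<open>L G\<close> fall into
  \<open>m\<close> classes of \<open>d\<close> twins with equal in-neighbourhoods, one class for each vertex of \<open>G\<close>, and
  everything follows from this.

  Zero forcing, nullity and rank. Twins give equal columns of the adjacency matrix of \<open>L G\<close>, whose
  rank is therefore at most \<open>m\<close> (\<open>line_digraph_matrix_rank_le\<close>). A kernel vector of a matrix with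
  the pattern of a digraph that vanishes on a zero forcing set vanishes everywhere, so
  the nullity never exceeds the zero forcing number (\<open>kernel_dim_le_card_zero_forcing_set\<close>). It
  remains to find a zero forcing set that misses exactly one arc at each vertex of \<open>G\<close>, and the
  complement of a one-factor is such a set (\<open>zero_forcing_set_line_digraph\<close>). With \<open>M\<close>
  the maximum nullity and \<open>Z\<close> the zero forcing number, the chain
  \<open>d m - m \<le> M \<le> Z \<le> d m - m\<close> thus closes, and rank-nullity turns \<open>M\<close> into the minimum rank.

  Power domination. Of two white twins neither can ever be forced, so after the domination step at
  most one out-arc of each vertex of \<open>G\<close> is white. Let \<open>T\<close> be the set of heads of the arcs in \<open>S\<close>.
  Out-arcs of a vertex outside \<open>T\<close> are not dominated from elsewhere, so \<open>d - 1\<close> of them lie in \<open>S\<close>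
  itself. Counting both kinds of vertices gives \<open>(d - 1) m \<le> d |S|\<close>
  (\<open>power_dominating_set_line_digraph_lower\<close>). Equality is attained for \<open>G = L F\<close> by a set that is
  built from a one-factor of \<open>F\<close> (\<open>power_dominating_set_line_line_digraph\<close>).

  One-factors exist for the complete digraph (a cyclic shift) and for every line digraph of a
  regular digraph (match the in-arcs with the out-arcs at each vertex), hence along the whole
  iteration.
\<close>

section \<open>Rank and nullity of matrices\<close>

lemma rank_plus_kernel_dim:
  fixes A :: "'a :: field mat"
  assumes A: "A \<in> carrier_mat nr nc"
  shows "vec_space.rank nr A + kernel_dim A = nc"
proof -
  interpret K: kernel nr nc A by unfold_locales (rule A)
  interpret W: vec_space "TYPE('a)" nr .
  interpret T: linear_map class_ring "module_vec TYPE('a) nc" "module_vec TYPE('a) nr" "\<lambda>v. A *\<^sub>v v"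
    using A by unfold_locales
      (auto simp: LinearCombinations.module_hom_def mult_add_distrib_mat_vec[OF A] mult_mat_vec[OF A]
        module_vec_def)
  have "T.imT = {y \<in> carrier_vec (dim_row A). \<exists>x\<in>carrier_vec (dim_col A). A *\<^sub>v x = y}"
    using A unfolding T.im_def by (auto simp: module_vec_def)
  also have "\<dots> = W.span (set (cols A))"
    using W.col_space_eq[OF A] by (simp add: W.col_space_def)
  finally have "T.imT = W.span (set (cols A))" .
  moreover have "T.kerT = mat_kernel A"
    using A unfolding T.ker_def mat_kernel_def by (auto simp: module_vec_def)
  ultimately show ?thesis using T.rank_nullity[OF K.NC.fin_dim]
    unfolding K.kernel_dim W.rank_def K.NC.dim_is_n by simp
qed

text \<open>
  If the coordinates in \<open>I\<close> determine a kernel vector, then restriction to \<open>I\<close> embeds the kernel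
  linearly into a space of dimension \<open>card I\<close>.
\<close>

lemma kernel_dim_le_card_determining:
  fixes A :: "'a :: field mat"
  assumes A: "A \<in> carrier_mat nr nc" and I: "I \<subseteq> {..<nc}"
    and det: "\<And>x. x \<in> mat_kernel A \<Longrightarrow> (\<forall>i\<in>I. x $ i = 0) \<Longrightarrow> x = 0\<^sub>v nc"
  shows "kernel_dim A \<le> card I"
proof -
  define q where "q = card I"
  have "finite I" using I finite_subset by blast
  then obtain s where s: "bij_betw s {..<q} I"
    using ex_bij_betw_nat_finite[of I] by (auto simp: q_def atLeast0LessThan)
  then have s_less: "s i < nc" if "i < q" for i
    using I that by (auto simp: bij_betw_def)
  interpret K: kernel nr nc A by unfold_locales (rule A)
  interpret W: vec_space "TYPE('a)" q .
  have fK: "K.Ker.fin_dim"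
    using kernel_basis_exists[OF A] by (auto simp: K.Ker.fin_dim_def K.Ker.basis_def)
  have kc: "mat_kernel A \<subseteq> carrier_vec nc" by (rule mat_kernel_carrier[OF A])
  let ?T = "\<lambda>x. vec q (\<lambda>i. x $ s i)"
  have hom: "?T \<in> LinearCombinations.module_hom class_ring K.VK W.V"
    unfolding LinearCombinations.module_hom_def using kc s_less
    by (auto intro!: eq_vecI simp: module_vec_def)
  have lm: "linear_map class_ring K.VK W.V ?T"
    by (intro linear_map.intro mod_hom.intro mod_hom_axioms.intro hom
       K.Ker.vectorspace_axioms W.vectorspace_axioms K.Ker.module_axioms W.module_axioms)
  then interpret T: linear_map class_ring K.VK W.V ?T .
  have inj: "inj_on ?T (carrier K.VK)"
  proof -
    have "T.kerT = {\<zero>\<^bsub>K.VK\<^esub>}"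
    proof (intro equalityI subsetI)
      fix x assume "x \<in> T.kerT"
      then have x: "x \<in> mat_kernel A" and Tx: "?T x = 0\<^sub>v q"
        unfolding T.ker_def by (auto simp: module_vec_def)
      have "x $ i = 0" if "i \<in> I" for i
      proof -
        have "i \<in> s ` {..<q}" using s that by (simp add: bij_betw_def)
        then obtain k where k: "k < q" "i = s k" by auto
        then show ?thesis using arg_cong[OF Tx, of "\<lambda>y. y $ k"] by simp
      qed
      then show "x \<in> {\<zero>\<^bsub>K.VK\<^esub>}" using det[OF x] by simp
    next
      fix x assume "x \<in> {\<zero>\<^bsub>K.VK\<^esub>}"
      then show "x \<in> T.kerT"
        using A s_less unfolding T.ker_def
        by (auto simp: module_vec_def mat_kernel_def intro!: eq_vecI)
    qed
    then show ?thesis by (intro T.Ke0_imp_inj) simp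
  qed
  have im: "?T ` mat_kernel A = T.imT" by (simp add: T.im_def)
  \<comment> \<open>The dimension of the image can be compared with that of the whole space once the image is
    known to be finite-dimensional, which follows by viewing the map as onto its image.\<close>
  have "linear_map class_ring K.VK (W.vs T.imT) ?T"
  proof (intro linear_map.intro mod_hom.intro mod_hom_axioms.intro K.Ker.vectorspace_axioms
      K.Ker.module_axioms W.subspace_is_vs[OF T.imT_is_subspace])
    show "module class_ring (W.vs T.imT)"
      using W.subspace_is_vs[OF T.imT_is_subspace] by (simp add: vectorspace_def)
    show "?T \<in> LinearCombinations.module_hom class_ring K.VK (W.vs T.imT)"
      using hom im by (auto simp: LinearCombinations.module_hom_def)
  qed
  then have fin_im: "vectorspace.fin_dim class_ring (W.vs T.imT)"
    by (rule linear_map.surj_fin_dim[OF _ fK]) (simp add: im)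
  have "K.dim = vectorspace.dim class_ring (W.vs T.imT)"
    using T.rank_nullity[OF fK] T.inj_imp_dim_ker0[OF inj] by simp
  also have "\<dots> \<le> W.dim"
    by (rule W.subspace_dim[OF T.imT_is_subspace W.fin_dim fin_im])
  finally show ?thesis unfolding W.dim_is_n by (simp add: q_def)
qed

lemma rank_le_card_cols:
  fixes A :: "'a :: field mat"
  assumes A: "A \<in> carrier_mat nr nc"
  shows "vec_space.rank nr A \<le> card (set (cols A))"
proof -
  interpret W: vec_space "TYPE('a)" nr .
  obtain B where B: "maximal B (\<lambda>T. T \<subseteq> set (cols A) \<and> W.lin_indpt T)"
    using maximal_exists_superset[of "set (cols A)" "\<lambda>T. T \<subseteq> set (cols A) \<and> W.lin_indpt T" "{}"]
    by (auto simp: W.lin_dep_def)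
  then have "B \<subseteq> set (cols A)" by (simp add: maximal_def)
  then show ?thesis
    using W.rank_card_indpt[OF A B] by (simp add: card_mono)
qed

section \<open>Zero forcing and power domination\<close>

definition in_nbrs :: "'a pair_pre_digraph \<Rightarrow> 'a \<Rightarrow> 'a set" where
  "in_nbrs H v = {u. (u, v) \<in> parcs H}"

lemma force_stepI:
  assumes "B \<subseteq> pverts H" "u \<in> B" "a \<in> pverts H" "out_nbrs H u - B = {a}"
  shows "a \<in> force_step H B"
proof -
  have "a \<notin> B" using assms(4) by blast
  moreover have "u \<in> (if has_loop H then pverts H else B)" using assms(1,2) by auto
  ultimately show ?thesis using assms(3,4) unfolding force_step_def by blast
qed

text \<open>
  A vertex that could force \<open>a\<close> has the white twin \<open>b\<close> as a second white out-neighbour.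
\<close>

lemma force_step_twins:
  assumes "in_nbrs H a = in_nbrs H b" "a \<noteq> b" "a \<notin> B" "b \<notin> B"
  shows "a \<notin> force_step H B"
proof
  assume "a \<in> force_step H B"
  then obtain u where u: "out_nbrs H u - B = {a}"
    using \<open>a \<notin> B\<close> by (auto simp: force_step_def)
  then have "u \<in> in_nbrs H a" by (auto simp: out_nbrs_def in_nbrs_def)
  then have "b \<in> out_nbrs H u - B"
    using assms by (auto simp: out_nbrs_def in_nbrs_def)
  then show False using u \<open>a \<noteq> b\<close> by auto
qed

lemma power_step_twins:
  assumes tw: "in_nbrs H a = in_nbrs H b" "a \<noteq> b"
    and S: "a \<notin> closed_out_nbrs H S" "b \<notin> closed_out_nbrs H S"
  shows "a \<notin> power_step H t S \<and> b \<notin> power_step H t S"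
proof -
  have later: "a \<notin> power_step H (Suc i) S \<and> b \<notin> power_step H (Suc i) S" for i
  proof (induction i)
    case 0
    then show ?case using S by simp
  next
    case (Suc i)
    then show ?case
      using force_step_twins[OF tw] force_step_twins[OF tw(1)[symmetric] tw(2)[symmetric]] by simp
  qed
  show ?thesis
    using S later by (cases t) (auto simp: closed_out_nbrs_def)
qed

lemma power_dominating_set_twins:
  assumes "power_dominating_set H S" "in_nbrs H a = in_nbrs H b" "a \<in> pverts H" "b \<in> pverts H"
    "a \<notin> closed_out_nbrs H S" "b \<notin> closed_out_nbrs H S"
  shows "a = b"
  using assms power_step_twins[of H a b S] unfolding power_dominating_set_def by metis

lemma zero_forcing_number_eqI:
  assumes fin: "finite (pverts H)"
    and S: "zero_forcing_set H S" "card S = k"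
    and least: "\<And>S. zero_forcing_set H S \<Longrightarrow> k \<le> card S"
  shows "zero_forcing_number H = k"
proof -
  have "finite {S. zero_forcing_set H S}"
    using fin by (rule_tac finite_subset[of _ "Pow (pverts H)"]) (auto simp: zero_forcing_set_def)
  then show ?thesis
    unfolding zero_forcing_number_def using S least by (intro Min_eqI) auto
qed

lemma power_domination_number_eqI:
  assumes fin: "finite (pverts H)"
    and S: "power_dominating_set H S" "card S = k"
    and least: "\<And>S. power_dominating_set H S \<Longrightarrow> k \<le> card S"
  shows "power_domination_number H = k"
proof -
  have "finite {S. power_dominating_set H S}"
    using fin by (rule_tac finite_subset[of _ "Pow (pverts H)"]) (auto simp: power_dominating_set_def)
  then show ?thesis
    unfolding power_domination_number_def using S least by (intro Min_eqI) auto
qed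

section \<open>Nullity is at most the size of a zero forcing set\<close>

text \<open>
  The algebraic content of the colour change rule: when \<open>u\<close> forces \<open>f k\<close>, the equation of row \<open>u\<close>
  reduces to a single term, whose coefficient is nonzero.
\<close>

lemma forced_kernel_vector_vanishes:
  assumes X: "X \<in> carrier_mat p p" and f: "bij_betw f {..<p} (pverts H)"
    and pattern: "\<And>i j. i < p \<Longrightarrow> j < p \<Longrightarrow> has_loop H \<or> i \<noteq> j \<Longrightarrow>
      X $$ (i, j) \<noteq> 0 \<longleftrightarrow> (f i, f j) \<in> parcs H"
    and B: "B \<subseteq> pverts H" and x: "x \<in> mat_kernel (X :: 'b :: field mat)"
    and zero: "\<And>j. j < p \<Longrightarrow> f j \<in> B \<Longrightarrow> x $ j = 0"
    and k: "k < p" "f k \<in> force_step H B"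
  shows "x $ k = 0"
proof (cases "f k \<in> B")
  case False
  then obtain u where u: "u \<in> (if has_loop H then pverts H else B)" "out_nbrs H u - B = {f k}"
    using k(2) unfolding force_step_def by auto
  then have "u \<in> pverts H" using B by (auto split: if_splits)
  then have "u \<in> f ` {..<p}" using f by (simp add: bij_betw_def)
  then obtain i where i: "i < p" "f i = u" by auto
  have xc: "x \<in> carrier_vec p" and Xx: "X *\<^sub>v x = 0\<^sub>v p" using mat_kernelD[OF X x] by auto
  \<comment> \<open>In row \<open>i\<close> of \<open>X x = 0\<close> only the term at \<open>k\<close> can survive. The diagonal entry is free when \<open>H\<close>
    has no loop, but then \<open>u\<close> is blue, so that \<open>x $ i = 0\<close>.\<close>
  have other: "X $$ (i, j) * x $ j = 0" if j: "j < p" "j \<noteq> k" for j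
  proof (cases "f j \<in> B")
    case True
    then show ?thesis using zero j by simp
  next
    case fj: False
    have "f j \<noteq> f k" using f j k(1) by (auto simp: bij_betw_def inj_on_def)
    then have "(f i, f j) \<notin> parcs H" using u(2) i fj by (auto simp: out_nbrs_def)
    moreover have "has_loop H \<or> i \<noteq> j" using u(1) i fj by (auto split: if_splits)
    ultimately show ?thesis using pattern[OF i(1) j(1)] by simp
  qed
  have "X $$ (i, k) \<noteq> 0"
  proof -
    have "has_loop H \<or> i \<noteq> k" using u(1) i False by (auto split: if_splits)
    moreover have "(f i, f k) \<in> parcs H" using u(2) i by (auto simp: out_nbrs_def)
    ultimately show ?thesis using pattern[OF i(1) k(1)] by simp
  qed
  moreover have "X $$ (i, k) * x $ k = (\<Sum>j<p. X $$ (i, j) * x $ j)"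
  proof -
    have "(\<Sum>j\<in>{..<p} - {k}. X $$ (i, j) * x $ j) = 0"
      by (rule sum.neutral) (use other in blast)
    then show ?thesis using k(1) by (simp add: sum.remove[of "{..<p}" k])
  qed
  moreover have "\<dots> = (X *\<^sub>v x) $ i"
    using i(1) X xc by (auto simp: scalar_prod_def atLeast0LessThan intro!: sum.cong)
  ultimately show ?thesis using Xx i(1) by simp
qed (use zero k in simp)

lemma kernel_dim_le_card_zero_forcing_set:
  assumes fin: "finite (pverts H)" and X: "X \<in> digraph_matrices H" and S: "zero_forcing_set H S"
  shows "kernel_dim X \<le> card S"
proof -
  define p where "p = card (pverts H)"
  obtain f where Xc: "X \<in> carrier_mat p p" and f: "bij_betw f {..<p} (pverts H)"
    and pattern: "\<And>i j. i < p \<Longrightarrow> j < p \<Longrightarrow> has_loop H \<or> i \<noteq> j \<Longrightarrow>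
      X $$ (i, j) \<noteq> 0 \<longleftrightarrow> (f i, f j) \<in> parcs H"
    using X by (auto simp: digraph_matrices_def Let_def p_def)
  have SV: "S \<subseteq> pverts H" using S by (simp add: zero_forcing_set_def)
  obtain m where m: "(force_step H ^^ m) S = pverts H" using S by (auto simp: zero_forcing_set_def)
  define I where "I = {i. i < p \<and> f i \<in> S}"
  have sub: "(force_step H ^^ t) S \<subseteq> pverts H" for t
    using SV by (induction t) (auto simp: force_step_def)
  have "kernel_dim X \<le> card I"
  proof (rule kernel_dim_le_card_determining[OF Xc])
    fix x assume x: "x \<in> mat_kernel X" and zero: "\<forall>i\<in>I. x $ i = 0"
    have "\<forall>k<p. f k \<in> (force_step H ^^ t) S \<longrightarrow> x $ k = 0" for t
    proof (induction t)
      case 0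
      then show ?case using zero by (simp add: I_def)
    next
      case (Suc t)
      show ?case
        using forced_kernel_vector_vanishes[OF Xc f pattern sub[of t] x] Suc by auto
    qed
    then have "\<forall>k<p. x $ k = 0" using m f by (metis bij_betwE lessThan_iff)
    then show "x = 0\<^sub>v p" using mat_kernelD[OF Xc x] by (intro eq_vecI) auto
  qed (auto simp: I_def)
  also have "card I \<le> card S"
  proof (rule card_inj_on_le[of f])
    show "inj_on f I" using f by (auto simp: bij_betw_def I_def intro: inj_on_subset)
    show "finite S" using SV fin finite_subset by blast
  qed (auto simp: I_def)
  finally show ?thesis .
qed

section \<open>Regular digraphs and one-factors\<close>

definition regular_digraph :: "nat \<Rightarrow> 'a pair_pre_digraph \<Rightarrow> bool" where
  "regular_digraph d G \<longleftrightarrow>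
     finite (pverts G) \<and> pverts G \<noteq> {} \<and> parcs G \<subseteq> pverts G \<times> pverts G \<and>
     (\<forall>v\<in>pverts G. card (out_nbrs G v) = d \<and> card (in_nbrs G v) = d)"

definition one_factor :: "'a pair_pre_digraph \<Rightarrow> ('a \<Rightarrow> 'a) \<Rightarrow> bool" where
  "one_factor G \<pi> \<longleftrightarrow> bij_betw \<pi> (pverts G) (pverts G) \<and> (\<forall>v\<in>pverts G. (v, \<pi> v) \<in> parcs G)"

lemma regular_digraphD:
  assumes "regular_digraph d G"
  shows "finite (pverts G)" "pverts G \<noteq> {}" "parcs G \<subseteq> pverts G \<times> pverts G"
    "finite (out_nbrs G v)" "finite (in_nbrs G v)"
    "out_nbrs G v \<subseteq> pverts G" "in_nbrs G v \<subseteq> pverts G"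
    "v \<in> pverts G \<Longrightarrow> card (out_nbrs G v) = d" "v \<in> pverts G \<Longrightarrow> card (in_nbrs G v) = d"
proof -
  show 1: "finite (pverts G)" "pverts G \<noteq> {}" "parcs G \<subseteq> pverts G \<times> pverts G"
    "v \<in> pverts G \<Longrightarrow> card (out_nbrs G v) = d" "v \<in> pverts G \<Longrightarrow> card (in_nbrs G v) = d"
    using assms by (auto simp: regular_digraph_def)
  show 2: "out_nbrs G v \<subseteq> pverts G" "in_nbrs G v \<subseteq> pverts G"
    using 1 by (auto simp: out_nbrs_def in_nbrs_def)
  show "finite (out_nbrs G v)" "finite (in_nbrs G v)"
    using 1 2 finite_subset by blast+
qed

lemma card_parcs_regular:
  assumes "regular_digraph d G"
  shows "card (parcs G) = d * card (pverts G)"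
proof -
  note R = regular_digraphD[OF assms]
  have "parcs G = Sigma (pverts G) (out_nbrs G)"
    using R(3) by (auto simp: out_nbrs_def)
  then show ?thesis using R by (simp add: card_SigmaI)
qed

text \<open>
  A one-factor is injective, so at most one of the in-neighbours of \<open>v\<close> is mapped to \<open>v\<close>.
\<close>

lemma in_nbr_avoiding:
  assumes G: "regular_digraph d G" and d: "d \<ge> 2" and \<pi>: "one_factor G \<pi>" and v: "v \<in> pverts G"
  shows "\<exists>u. (u, v) \<in> parcs G \<and> \<pi> u \<noteq> v"
proof (rule ccontr)
  note R = regular_digraphD[OF G]
  assume "\<not> ?thesis"
  then have "\<forall>u\<in>in_nbrs G v. \<pi> u = v" by (auto simp: in_nbrs_def)
  moreover have "inj_on \<pi> (in_nbrs G v)"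
    using \<pi> R(7) by (auto simp: one_factor_def bij_betw_def intro: inj_on_subset)
  ultimately have "card (in_nbrs G v) \<le> 1"
    using card_inj_on_le[of \<pi> "in_nbrs G v" "{v}"] by auto
  then show False using R(9)[OF v] d by simp
qed

section \<open>Line digraphs of regular digraphs\<close>

lemma pverts_line_digraph: "pverts (line_digraph G) = (\<lambda>(u, v). Arc u v) ` parcs G"
  by (auto simp: line_digraph_def)

lemma Arc_in_line_digraph [simp]: "Arc u v \<in> pverts (line_digraph G) \<longleftrightarrow> (u, v) \<in> parcs G"
  by (auto simp: pverts_line_digraph)

lemma arc_line_digraph [simp]:
  "(Arc u v, Arc x y) \<in> parcs (line_digraph G) \<longleftrightarrow> (u, v) \<in> parcs G \<and> (x, y) \<in> parcs G \<and> v = x"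
  by (auto simp: line_digraph_def)

lemma out_nbrs_line_digraph:
  "(u, v) \<in> parcs G \<Longrightarrow> out_nbrs (line_digraph G) (Arc u v) = Arc v ` out_nbrs G v"
  by (auto simp: out_nbrs_def line_digraph_def)

lemma in_nbrs_line_digraph:
  "(u, v) \<in> parcs G \<Longrightarrow> in_nbrs (line_digraph G) (Arc u v) = (\<lambda>t. Arc t u) ` in_nbrs G u"
  by (auto simp: in_nbrs_def line_digraph_def)

lemma card_pverts_line_digraph:
  assumes "regular_digraph d G"
  shows "card (pverts (line_digraph G)) = d * card (pverts G)"
  unfolding pverts_line_digraph card_parcs_regular[OF assms, symmetric]
  by (rule card_image) (auto simp: inj_on_def)

lemma regular_digraph_line_digraph:
  assumes G: "regular_digraph d G" and d: "d > 0"
  shows "regular_digraph d (line_digraph G)"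
  unfolding regular_digraph_def
proof (intro conjI ballI)
  note R = regular_digraphD[OF G]
  have "finite (parcs G)" using R(1,3) finite_subset by blast
  then show "finite (pverts (line_digraph G))" by (simp add: pverts_line_digraph)
  have "card (pverts (line_digraph G)) > 0"
    using R(1,2) d by (auto simp: card_pverts_line_digraph[OF G] card_gt_0_iff)
  then show "pverts (line_digraph G) \<noteq> {}" by force
  show "parcs (line_digraph G) \<subseteq> pverts (line_digraph G) \<times> pverts (line_digraph G)"
    by (auto simp: line_digraph_def)
  fix a assume "a \<in> pverts (line_digraph G)"
  then obtain u v where a: "a = Arc u v" and uv: "(u, v) \<in> parcs G"
    by (auto simp: pverts_line_digraph)
  then have "u \<in> pverts G" "v \<in> pverts G" using R(3) by auto
  then show "card (out_nbrs (line_digraph G) a) = d" "card (in_nbrs (line_digraph G) a) = d"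
    unfolding a out_nbrs_line_digraph[OF uv] in_nbrs_line_digraph[OF uv]
    using R by (simp_all add: card_image inj_on_def)
qed

text \<open>
  At each vertex \<open>y\<close> of \<open>G\<close> a bijection \<open>\<beta> y\<close> sends the \<open>d\<close> in-arcs to the \<open>d\<close> out-arcs; together these
  bijections permute the arcs of \<open>G\<close>, and each arc is followed by its image.
\<close>

lemma one_factor_line_digraph:
  assumes G: "regular_digraph d G" and d: "d > 0"
  shows "\<exists>\<pi>. one_factor (line_digraph G) \<pi>"
proof -
  note R = regular_digraphD[OF G]
  have "\<forall>y\<in>pverts G. \<exists>b. bij_betw b (in_nbrs G y) (out_nbrs G y)"
    using R by (auto intro: finite_same_card_bij)
  then obtain \<beta> where \<beta>: "\<And>y. y \<in> pverts G \<Longrightarrow> bij_betw (\<beta> y) (in_nbrs G y) (out_nbrs G y)"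
    by metis
  define \<pi> where "\<pi> a = (case a of Arc x y \<Rightarrow> Arc y (\<beta> y x) | Vertex i \<Rightarrow> Vertex i)" for a :: "'a line_vertex"
  have y: "y \<in> pverts G \<and> x \<in> in_nbrs G y" if "(x, y) \<in> parcs G" for x y
    using that R(3) by (auto simp: in_nbrs_def)
  have step: "(y, \<beta> y x) \<in> parcs G" if "(x, y) \<in> parcs G" for x y
    using bij_betwE[OF \<beta>] y[OF that] by (auto simp: out_nbrs_def)
  have "inj_on \<pi> (pverts (line_digraph G))"
  proof (rule inj_onI)
    fix a a' assume "a \<in> pverts (line_digraph G)" "a' \<in> pverts (line_digraph G)" and eq: "\<pi> a = \<pi> a'"
    then obtain x y x' y' where a: "a = Arc x y" "a' = Arc x' y'"
      and arcs: "(x, y) \<in> parcs G" "(x', y') \<in> parcs G"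
      by (auto simp: pverts_line_digraph)
    have "y = y'" "\<beta> y x = \<beta> y x'" using eq by (auto simp: a \<pi>_def)
    then show "a = a'"
      using \<beta>[of y] y[OF arcs(1)] y[OF arcs(2)] by (auto simp: a bij_betw_def inj_on_def)
  qed
  moreover have "\<pi> ` pverts (line_digraph G) \<subseteq> pverts (line_digraph G)"
    using step by (auto simp: line_digraph_def \<pi>_def)
  moreover have "finite (pverts (line_digraph G))"
    using regular_digraphD(1)[OF regular_digraph_line_digraph[OF G d]] .
  ultimately have "bij_betw \<pi> (pverts (line_digraph G)) (pverts (line_digraph G))"
    by (simp add: bij_betw_def endo_inj_surj)
  moreover have "\<forall>a\<in>pverts (line_digraph G). (a, \<pi> a) \<in> parcs (line_digraph G)"
    using step by (auto simp: pverts_line_digraph \<pi>_def)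
  ultimately show ?thesis by (auto simp: one_factor_def)
qed

section \<open>Zero forcing number, maximum nullity and minimum rank of a line digraph\<close>

text \<open>
  All arcs outside the one-factor are blue. Some in-arc \<open>(u, v)\<close> of \<open>v\<close> lies outside the
  one-factor, and its only white out-neighbour is the factor arc at \<open>v\<close>, so one step colours
  everything.
\<close>

lemma zero_forcing_set_line_digraph:
  assumes G: "regular_digraph d G" and d: "d \<ge> 2" and \<pi>: "one_factor G \<pi>"
  shows "\<exists>S. zero_forcing_set (line_digraph G) S \<and> card S = (d - 1) * card (pverts G)"
proof -
  note R = regular_digraphD[OF G]
  let ?L = "line_digraph G"
  define M where "M = (\<lambda>v. Arc v (\<pi> v)) ` pverts G"
  define S where "S = pverts ?L - M"
  have finL: "finite (pverts ?L)"
    using regular_digraphD(1)[OF regular_digraph_line_digraph[OF G]] d by simp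
  have M_arcs: "M \<subseteq> pverts ?L" using \<pi> by (auto simp: M_def one_factor_def)
  have "card M = card (pverts G)" unfolding M_def by (rule card_image) (auto simp: inj_on_def)
  then have card: "card S = (d - 1) * card (pverts G)"
    using card_Diff_subset[of M "pverts ?L"] M_arcs finite_subset[OF M_arcs finL]
    by (simp add: S_def card_pverts_line_digraph[OF G] diff_mult_distrib)
  have "a \<in> force_step ?L S" if aM: "a \<in> M" for a
  proof -
    obtain v where v: "v \<in> pverts G" "a = Arc v (\<pi> v)" using aM by (auto simp: M_def)
    obtain u where u: "(u, v) \<in> parcs G" "\<pi> u \<noteq> v" using in_nbr_avoiding[OF G d \<pi> v(1)] by blast
    have "out_nbrs ?L (Arc u v) - S = {a}"
      using v \<pi> unfolding out_nbrs_line_digraph[OF u(1)]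
      by (auto simp: S_def M_def out_nbrs_def one_factor_def)
    moreover have "Arc u v \<in> S" using u by (auto simp: S_def M_def)
    moreover have "a \<in> pverts ?L - S" using aM M_arcs by (auto simp: S_def)
    moreover have "S \<subseteq> pverts ?L" by (auto simp: S_def)
    ultimately show ?thesis by (intro force_stepI[of S ?L "Arc u v"]) auto
  qed
  moreover have "S \<subseteq> force_step ?L S" "force_step ?L S \<subseteq> pverts ?L"
    by (auto simp: force_step_def S_def)
  ultimately have "force_step ?L S = pverts ?L" unfolding S_def by blast
  then have "(force_step ?L ^^ 1) S = pverts ?L" by simp
  moreover have "S \<noteq> {}"
    using card R(1,2) d by auto
  ultimately have "zero_forcing_set ?L S"
    unfolding zero_forcing_set_def S_def by blast
  then show ?thesis using card by blast
qed

text \<open>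
  The column of the adjacency matrix at the arc \<open>(v, z)\<close> is the indicator \<open>c v\<close> of the arcs with head
  \<open>v\<close>, so there are at most as many distinct columns as vertices of \<open>G\<close>.
\<close>

lemma line_digraph_matrix_rank_le:
  assumes G: "regular_digraph d G" and d: "d > 0"
  shows "\<exists>X\<in>digraph_matrices (line_digraph G).
           vec_space.rank (card (pverts (line_digraph G))) X \<le> card (pverts G)"
proof -
  note R = regular_digraphD[OF G]
  let ?L = "line_digraph G"
  define p where "p = card (pverts ?L)"
  have "finite (pverts ?L)" using regular_digraphD(1)[OF regular_digraph_line_digraph[OF G d]] .
  then obtain f where f: "bij_betw f {..<p} (pverts ?L)"
    using ex_bij_betw_nat_finite[of "pverts ?L"] by (auto simp: p_def atLeast0LessThan)
  define X :: "real mat" where "X = mat p p (\<lambda>(i, j). of_bool ((f i, f j) \<in> parcs ?L))"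
  define c :: "'a line_vertex \<Rightarrow> real vec" where
    "c v = vec p (\<lambda>i. of_bool (\<exists>u. f i = Arc u v))" for v
  have X: "X \<in> carrier_mat p p" by (simp add: X_def)
  have "X \<in> digraph_matrices ?L"
    using X f unfolding digraph_matrices_def Let_def p_def[symmetric]
    by (auto simp: X_def)
  moreover have "set (cols X) \<subseteq> c ` pverts G"
  proof
    fix w assume "w \<in> set (cols X)"
    then obtain j where j: "j < p" "w = col X j" using X by (auto simp: cols_def)
    have fV: "f i \<in> pverts ?L" if "i < p" for i using f that by (auto simp: bij_betw_def)
    then obtain v z where vz: "(v, z) \<in> parcs G" "f j = Arc v z"
      using fV[OF j(1)] by (auto simp: pverts_line_digraph)
    have "w = c v"
    proof (rule eq_vecI)
      fix i assume "i < dim_vec (c v)"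
      then have i: "i < p" by (simp add: c_def)
      obtain u y where "(u, y) \<in> parcs G" "f i = Arc u y"
        using fV[OF i] by (auto simp: pverts_line_digraph)
      then show "w $ i = c v $ i" using i j vz by (simp add: X_def c_def)
    qed (use j X in \<open>simp add: c_def\<close>)
    then show "w \<in> c ` pverts G" using vz R(3) by auto
  qed
  then have "card (set (cols X)) \<le> card (pverts G)"
    using R(1) by (meson card_image_le card_mono finite_imageI le_trans)
  then have "vec_space.rank p X \<le> card (pverts G)"
    using rank_le_card_cols[OF X] by simp
  ultimately show ?thesis unfolding p_def by blast
qed

lemma line_digraph_parameters:
  assumes G: "regular_digraph d G" and d: "d \<ge> 2" and \<pi>: "one_factor G \<pi>"
  shows "zero_forcing_number (line_digraph G) = (d - 1) * card (pverts G)"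
    and "max_nullity (line_digraph G) = (d - 1) * card (pverts G)"
    and "min_rank (line_digraph G) = card (pverts G)"
proof -
  let ?L = "line_digraph G" and ?m = "card (pverts G)"
  let ?p = "card (pverts ?L)"
  have d0: "d > 0" using d by simp
  have p: "?p = (d - 1) * ?m + ?m"
    using d by (cases d) (auto simp: card_pverts_line_digraph[OF G])
  have fin: "finite (pverts ?L)"
    using regular_digraphD(1)[OF regular_digraph_line_digraph[OF G d0]] .
  have mats: "X \<in> carrier_mat ?p ?p" if "X \<in> digraph_matrices ?L" for X
    using that by (auto simp: digraph_matrices_def Let_def)
  have rn: "vec_space.rank ?p X + kernel_dim X = ?p" if "X \<in> digraph_matrices ?L" for X
    using rank_plus_kernel_dim[OF mats[OF that]] .
  obtain S where S: "zero_forcing_set ?L S" "card S = (d - 1) * ?m"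
    using zero_forcing_set_line_digraph[OF G d \<pi>] by blast
  have upper: "kernel_dim X \<le> (d - 1) * ?m" if "X \<in> digraph_matrices ?L" for X
    using kernel_dim_le_card_zero_forcing_set[OF fin that S(1)] S(2) by simp
  obtain A where A: "A \<in> digraph_matrices ?L" "vec_space.rank ?p A \<le> ?m"
    using line_digraph_matrix_rank_le[OF G d0] by blast
  have kA: "kernel_dim A = (d - 1) * ?m" using rn[OF A(1)] A(2) upper[OF A(1)] p by linarith
  have rA: "vec_space.rank ?p A = ?m" using rn[OF A(1)] kA p by linarith
  show "zero_forcing_number ?L = (d - 1) * ?m"
  proof (rule zero_forcing_number_eqI[OF fin S])
    fix S assume "zero_forcing_set ?L S"
    then show "(d - 1) * ?m \<le> card S"
      using kernel_dim_le_card_zero_forcing_set[OF fin A(1)] kA by simp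
  qed
  show "max_nullity ?L = (d - 1) * ?m"
    unfolding max_nullity_def
  proof (rule Max_eqI)
    show "finite (kernel_dim ` digraph_matrices ?L)"
      using upper by (auto intro: finite_subset[of _ "{..(d - 1) * ?m}"])
  qed (use upper A kA in force)+
  have lower: "?m \<le> vec_space.rank ?p X" if "X \<in> digraph_matrices ?L" for X
    using rn[OF that] upper[OF that] p by linarith
  show "min_rank ?L = ?m"
    unfolding min_rank_def
  proof (rule Min_eqI)
    have "vec_space.rank ?p X \<le> ?p" if "X \<in> digraph_matrices ?L" for X
      using rn[OF that] by linarith
    then show "finite (vec_space.rank ?p ` digraph_matrices ?L)"
      by (auto intro: finite_subset[of _ "{..?p}"])
  qed (use lower A rA in force)+
qed

section \<open>Power domination number of an iterated line digraph\<close>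

text \<open>
  Every vertex of \<open>G\<close> lies in the set \<open>T\<close> of heads of \<open>S\<close> or in its complement \<open>W\<close>. The bounds
  \<open>card T \<le> card S\<close> and \<open>(d - 1) * card W \<le> card S\<close>, the first weighted with \<open>d - 1\<close>, add up to the
  claim.
\<close>

lemma power_dominating_set_line_digraph_lower:
  assumes G: "regular_digraph d G" and d: "d > 0" and S: "power_dominating_set (line_digraph G) S"
  shows "(d - 1) * card (pverts G) \<le> d * card S"
proof -
  note R = regular_digraphD[OF G]
  let ?L = "line_digraph G"
  have SL: "S \<subseteq> pverts ?L" using S by (simp add: power_dominating_set_def)
  have "finite (parcs G)" using R(1,3) finite_subset by blast
  then have finS: "finite S" using SL finite_subset by (auto simp: pverts_line_digraph)
  define T where "T = {v. \<exists>u. Arc u v \<in> S}"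
  define W where "W = pverts G - T"
  define through where "through v = {a \<in> S. \<exists>z. a = Arc v z}" for v
  have TV: "T \<subseteq> pverts G" using SL R(3) by (force simp: T_def pverts_line_digraph)
  have cardT: "card T \<le> card S"
  proof -
    have "T \<subseteq> (\<lambda>a. case a of Arc u v \<Rightarrow> v | Vertex i \<Rightarrow> Vertex i) ` S"
      by (force simp: T_def)
    then show ?thesis using finS by (meson card_image_le card_mono finite_imageI le_trans)
  qed
  \<comment> \<open>Out-arcs of \<open>v \<notin> T\<close> can be dominated only by themselves, and no two of them may stay white.\<close>
  have through: "d - 1 \<le> card (through v)" if v: "v \<in> W" for v
  proof -
    define Y where "Y = {z \<in> out_nbrs G v. Arc v z \<notin> S}"
    have white: "Arc v z \<notin> closed_out_nbrs ?L S" if z: "z \<in> Y" for z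
    proof
      assume "Arc v z \<in> closed_out_nbrs ?L S"
      then obtain a where "a \<in> S" "(a, Arc v z) \<in> parcs ?L"
        using z by (auto simp: closed_out_nbrs_def out_nbrs_def Y_def)
      moreover obtain u w where "a = Arc u w" using SL \<open>a \<in> S\<close> by (auto simp: pverts_line_digraph)
      ultimately have "v \<in> T" by (auto simp: T_def)
      then show False using v by (simp add: W_def)
    qed
    have "z = z'" if "z \<in> Y" "z' \<in> Y" for z z'
      using power_dominating_set_twins[OF S, of "Arc v z" "Arc v z'"] white that
      by (auto simp: Y_def out_nbrs_def in_nbrs_line_digraph)
    moreover have Y: "Y \<subseteq> out_nbrs G v" by (auto simp: Y_def)
    moreover have "finite Y" using Y R(4) finite_subset by blast
    ultimately have "card Y \<le> 1" using card_le_Suc0_iff_eq[of Y] by auto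
    have "d - 1 \<le> card (out_nbrs G v - Y)"
      using v R(8)[of v] \<open>card Y \<le> 1\<close> diff_card_le_card_Diff[OF \<open>finite Y\<close>, of "out_nbrs G v"]
      by (simp add: W_def)
    also have "\<dots> = card (Arc v ` (out_nbrs G v - Y))" by (simp add: card_image inj_on_def)
    also have "\<dots> \<le> card (through v)"
      using finS by (intro card_mono) (auto simp: through_def Y_def)
    finally show ?thesis .
  qed
  have "(d - 1) * card W \<le> (\<Sum>v\<in>W. card (through v))"
    using sum_mono[of W "\<lambda>_. d - 1" "\<lambda>v. card (through v)"] through by (simp add: mult.commute)
  also have "\<dots> = card (\<Union>v\<in>W. through v)"
    using finS R(1) by (intro card_UN_disjoint[symmetric]) (auto simp: through_def W_def)
  also have "\<dots> \<le> card S" using finS by (intro card_mono) (auto simp: through_def)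
  finally have cardW: "(d - 1) * card W \<le> card S" .
  have "card (pverts G) = card W + card T"
    using card_Diff_subset[of T "pverts G"] card_mono[OF R(1) TV] finite_subset[OF TV R(1)] TV
    by (simp add: W_def)
  then have "(d - 1) * card (pverts G) = (d - 1) * card W + (d - 1) * card T"
    by (simp add: distrib_left)
  also have "\<dots> \<le> card S + (d - 1) * card S" using cardW cardT by (intro add_mono mult_le_mono2)
  also have "\<dots> = d * card S" using d by (cases d) auto
  finally show ?thesis .
qed

text \<open>
  For \<open>d \<ge> 3\<close>, equality in the preceding count forces the heads of \<open>S\<close> to be distinct, and at
  each vertex of \<open>F\<close> exactly one in-arc and one out-arc to be no head. So the arcs that are no heads
  form a one-factor. Accordingly \<open>S\<close> consists of the paths \<open>x, \<pi> x, z\<close> whose first arc is in the factor and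
  whose second arc is not. The white paths \<open>y, \<pi> y, \<pi> (\<pi> y)\<close> that are left by the domination step
  are all forced at once, by a path \<open>x, y, \<pi> y\<close> with \<open>\<pi> x \<noteq> y\<close>.
\<close>

lemma power_dominating_set_line_line_digraph:
  assumes F: "regular_digraph d F" and d: "d \<ge> 2" and \<pi>: "one_factor F \<pi>"
  shows "\<exists>S. power_dominating_set (line_digraph (line_digraph F)) S \<and>
             card S = (d - 1) * card (pverts F)"
proof -
  note R = regular_digraphD[OF F]
  let ?L = "line_digraph (line_digraph F)"
  have \<pi>V: "\<pi> v \<in> pverts F" and \<pi>arc: "(v, \<pi> v) \<in> parcs F" if "v \<in> pverts F" for v
    using \<pi> that by (auto simp: one_factor_def bij_betw_def)
  define I where "I = Sigma (pverts F) (\<lambda>x. out_nbrs F (\<pi> x) - {\<pi> (\<pi> x)})"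
  define S where "S = (\<lambda>(x, z). Arc (Arc x (\<pi> x)) (Arc (\<pi> x) z)) ` I"
  have "card (out_nbrs F (\<pi> x) - {\<pi> (\<pi> x)}) = d - 1" if "x \<in> pverts F" for x
    using R(4) R(8)[OF \<pi>V[OF that]] \<pi>arc[OF \<pi>V[OF that]] by (simp add: out_nbrs_def)
  then have "card I = (d - 1) * card (pverts F)"
    unfolding I_def using R by (simp add: card_SigmaI)
  moreover have "card S = card I"
    unfolding S_def by (rule card_image) (auto simp: inj_on_def)
  ultimately have card: "card S = (d - 1) * card (pverts F)" by simp
  have SL: "S \<subseteq> pverts ?L"
    using \<pi>arc by (auto simp: S_def I_def out_nbrs_def)
  define P where "P = closed_out_nbrs ?L S"
  have PL: "P \<subseteq> pverts ?L"
    using SL by (auto simp: P_def closed_out_nbrs_def out_nbrs_def line_digraph_def)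
  \<comment> \<open>A non-factor arc \<open>(y, z)\<close> is the head of the member of \<open>S\<close> that enters it from the factor arc
    ending in \<open>y\<close>, so everything that leaves \<open>(y, z)\<close> is dominated.\<close>
  have dominated: "Arc (Arc y z) b \<in> P"
    if yz: "(y, z) \<in> parcs F" "z \<noteq> \<pi> y" and b: "(Arc y z, b) \<in> parcs (line_digraph F)" for y z b
  proof -
    have "y \<in> \<pi> ` pverts F" using yz(1) R(3) \<pi> by (auto simp: one_factor_def bij_betw_def)
    then obtain x where x: "x \<in> pverts F" "y = \<pi> x" by auto
    have "Arc (Arc x y) (Arc y z) \<in> S"
      using x yz by (force simp: S_def I_def out_nbrs_def)
    moreover have "(Arc (Arc x y) (Arc y z), Arc (Arc y z) b) \<in> parcs ?L"
      using x yz b \<pi>arc by auto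
    ultimately show ?thesis unfolding P_def closed_out_nbrs_def out_nbrs_def by blast
  qed
  have chosen: "Arc (Arc y (\<pi> y)) (Arc (\<pi> y) z) \<in> P"
    if "y \<in> pverts F" "(\<pi> y, z) \<in> parcs F" "z \<noteq> \<pi> (\<pi> y)" for y z
  proof -
    have "(y, z) \<in> I" using that by (simp add: I_def out_nbrs_def)
    then have "Arc (Arc y (\<pi> y)) (Arc (\<pi> y) z) \<in> S" unfolding S_def by force
    then show ?thesis by (auto simp: P_def closed_out_nbrs_def)
  qed
  \<comment> \<open>Only two consecutive factor arcs remain white.\<close>
  have white: "\<exists>y\<in>pverts F. a = Arc (Arc y (\<pi> y)) (Arc (\<pi> y) (\<pi> (\<pi> y)))"
    if a: "a \<in> pverts ?L" "a \<notin> P" for a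
  proof -
    obtain y z w where a': "a = Arc (Arc y z) (Arc z w)" and arcs: "(y, z) \<in> parcs F" "(z, w) \<in> parcs F"
      using a(1) by (auto simp: line_digraph_def)
    have "y \<in> pverts F" using arcs R(3) by auto
    moreover have "z = \<pi> y" using dominated[of y z "Arc z w"] arcs a(2) a' by auto
    moreover have "w = \<pi> (\<pi> y)" using chosen[of y w] arcs a(2) a' calculation by auto
    ultimately show ?thesis using a' by blast
  qed
  have "a \<in> force_step ?L P" if a: "a \<in> pverts ?L" "a \<notin> P" for a
  proof -
    obtain y where y: "y \<in> pverts F" and a': "a = Arc (Arc y (\<pi> y)) (Arc (\<pi> y) (\<pi> (\<pi> y)))"
      using white[OF a] by blast
    obtain x where x: "(x, y) \<in> parcs F" "\<pi> x \<noteq> y" using in_nbr_avoiding[OF F d \<pi> y] by blast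
    let ?u = "Arc (Arc x y) (Arc y (\<pi> y))"
    have u: "?u \<in> P" using dominated[of x y "Arc y (\<pi> y)"] x \<pi>arc[OF y] by auto
    have "b = a" if "b \<in> out_nbrs ?L ?u" "b \<notin> P" for b
    proof -
      have "b \<in> pverts ?L" "\<exists>c. b = Arc (Arc y (\<pi> y)) c"
        using that(1) by (auto simp: out_nbrs_def line_digraph_def)
      then show ?thesis using white[OF _ that(2)] a' by auto
    qed
    moreover have "a \<in> out_nbrs ?L ?u"
      using x \<pi>arc[OF y] \<pi>arc[OF \<pi>V[OF y]] a' by (auto simp: out_nbrs_def)
    ultimately have "out_nbrs ?L ?u - P = {a}" using a(2) by blast
    then show ?thesis by (rule force_stepI[OF PL u a(1)])
  qed
  moreover have "P \<subseteq> force_step ?L P" "force_step ?L P \<subseteq> pverts ?L"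
    using PL by (auto simp: force_step_def)
  ultimately have "force_step ?L P = pverts ?L" by blast
  then have "power_step ?L (Suc (Suc 0)) S = pverts ?L" by (simp add: P_def)
  moreover have "S \<noteq> {}" using card R(1,2) d by auto
  ultimately have "power_dominating_set ?L S"
    unfolding power_dominating_set_def using SL by blast
  then show ?thesis using card by blast
qed

lemma power_domination_number_line_line_digraph:
  assumes F: "regular_digraph d F" and d: "d \<ge> 2" and \<pi>: "one_factor F \<pi>"
  shows "power_domination_number (line_digraph (line_digraph F)) = (d - 1) * card (pverts F)"
proof -
  let ?L = "line_digraph (line_digraph F)"
  have d0: "d > 0" using d by simp
  note G = regular_digraph_line_digraph[OF F d0]
  obtain S where S: "power_dominating_set ?L S" "card S = (d - 1) * card (pverts F)"
    using power_dominating_set_line_line_digraph[OF F d \<pi>] by blast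
  show ?thesis
  proof (rule power_domination_number_eqI[OF _ S])
    show "finite (pverts ?L)" using regular_digraphD(1)[OF regular_digraph_line_digraph[OF G d0]] .
    fix S assume "power_dominating_set ?L S"
    then have "d * ((d - 1) * card (pverts F)) \<le> d * card S"
      using power_dominating_set_line_digraph_lower[OF G d0, of S]
      by (simp add: card_pverts_line_digraph[OF F] mult.left_commute)
    then show "(d - 1) * card (pverts F) \<le> card S" using d0 by simp
  qed
qed

section \<open>Kautz digraphs\<close>

lemma regular_digraph_complete_loopless: "d > 0 \<Longrightarrow> regular_digraph d (complete_loopless (d + 1))"
  unfolding regular_digraph_def
proof (intro conjI ballI)
  fix v :: "nat line_vertex" assume "v \<in> pverts (complete_loopless (d + 1))"
  then have v: "v \<in> Vertex ` {..<d + 1}" by (simp add: complete_loopless_def)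
  have "out_nbrs (complete_loopless (d + 1)) v = Vertex ` {..<d + 1} - {v}"
    "in_nbrs (complete_loopless (d + 1)) v = Vertex ` {..<d + 1} - {v}"
    using v by (auto simp: out_nbrs_def in_nbrs_def complete_loopless_def)
  then show "card (out_nbrs (complete_loopless (d + 1)) v) = d"
    "card (in_nbrs (complete_loopless (d + 1)) v) = d"
    using v by (simp_all add: card_image inj_on_def)
qed (auto simp: complete_loopless_def)

lemma one_factor_complete_loopless: "d > 0 \<Longrightarrow> \<exists>\<pi>. one_factor (complete_loopless (d + 1)) \<pi>"
proof -
  assume d: "d > 0"
  define \<pi> :: "nat line_vertex \<Rightarrow> nat line_vertex" where
    "\<pi> v = (case v of Vertex i \<Rightarrow> Vertex (if i = d then 0 else Suc i) | Arc x y \<Rightarrow> v)" for v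
  have "inj_on \<pi> (Vertex ` {..<d + 1})"
    by (auto simp: inj_on_def \<pi>_def split: if_splits)
  moreover have "\<pi> ` Vertex ` {..<d + 1} \<subseteq> Vertex ` {..<d + 1}"
    by (auto simp: \<pi>_def)
  ultimately have "bij_betw \<pi> (Vertex ` {..<d + 1}) (Vertex ` {..<d + 1})"
    by (simp add: bij_betw_def endo_inj_surj)
  then have "one_factor (complete_loopless (d + 1)) \<pi>"
    using d by (auto simp: one_factor_def complete_loopless_def \<pi>_def)
  then show ?thesis by blast
qed

lemma kautz_Suc: "kautz d (Suc (Suc k)) = line_digraph (kautz d (Suc k))"
  by (simp add: kautz_def)

lemma kautz_structure:
  assumes "d > 0"
  shows "regular_digraph d (kautz d (Suc k)) \<and> card (pverts (kautz d (Suc k))) = d ^ k * (d + 1) \<and>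
    (\<exists>\<pi>. one_factor (kautz d (Suc k)) \<pi>)"
proof (induction k)
  case 0
  then show ?case using assms regular_digraph_complete_loopless[OF assms] one_factor_complete_loopless[OF assms]
    by (simp add: kautz_def) (simp add: complete_loopless_def card_image inj_on_def)
next
  case (Suc k)
  then have reg: "regular_digraph d (kautz d (Suc k))"
    and order: "card (pverts (kautz d (Suc k))) = d ^ k * (d + 1)" by blast+
  show ?case
    using regular_digraph_line_digraph[OF reg assms] one_factor_line_digraph[OF reg assms]
    unfolding kautz_Suc card_pverts_line_digraph[OF reg] order by (simp add: algebra_simps)
qed

theorem corollary5p2:
  fixes d D :: nat
  assumes "d \<ge> 3" and "D \<ge> 3"
  shows "zero_forcing_number (kautz d D) = (d - 1) * d ^ (D - 2) * (d + 1) \<and>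
         max_nullity (kautz d D) = (d - 1) * d ^ (D - 2) * (d + 1) \<and>
         min_rank (kautz d D) = d ^ (D - 2) * (d + 1) \<and>
         power_domination_number (kautz d D) = (d - 1) * d ^ (D - 3) * (d + 1)"
proof -
  define k where "k = D - 3"
  have D: "D = Suc (Suc (Suc k))" using assms(2) by (simp add: k_def)
  have d: "d > 0" "d \<ge> 2" using assms(1) by auto
  obtain \<pi> where F: "regular_digraph d (kautz d (Suc k))" "card (pverts (kautz d (Suc k))) = d ^ k * (d + 1)"
    "one_factor (kautz d (Suc k)) \<pi>" using kautz_structure[OF d(1), of k] by blast
  obtain \<rho> where G: "regular_digraph d (kautz d (Suc (Suc k)))"
    "card (pverts (kautz d (Suc (Suc k)))) = d ^ Suc k * (d + 1)"
    "one_factor (kautz d (Suc (Suc k))) \<rho>" using kautz_structure[OF d(1), of "Suc k"] by blast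
  have exps: "D - 2 = Suc k" "D - 3 = k" by (simp_all add: D)
  show ?thesis
    using line_digraph_parameters[OF G(1) d(2) G(3)]
      power_domination_number_line_line_digraph[OF F(1) d(2) F(3)]
    unfolding exps G(2) F(2) mult.assoc kautz_Suc[symmetric] D[symmetric] by blast
qed

end
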